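(* Let $\xi\in\mathbb C/2\mathbb Z$ and $\tau\in\mathbb C$ be arbitrary, and fix a square root $\sqrt\tau$. The dense $\mathfrak{sl}(2)$-module $\mathbb V(\xi,\tau)$ admits at most two compatible structures of $\mathbf{Witt}_{>}$-module. Moreover, these structures are explicitly given by $$\rho_{>}^{\pm}(L_i)v_\mu=\Big(\frac{(-1)^i}{2}\big(i(\pm\sqrt\tau-1)-\mu\big)\,P\big(\tfrac12(1+\mu\pm\sqrt\tau),i\big)\Big)v_{\mu+2i},\qquad i\ge-1,\ \mu\in\xi$$ (for $i=-1$ the coefficient is to be read as $1$). Moreover, both extensions coincide if and only if $\tau=0$ or $\tau=1$.
   Context: $\mathfrak{sl}(2)=\mathfrak{sl}(2,\mathbb C)$ has Chevalley basis $\{e,f,h\}$ with $[e,f]=h$, $[h,e]=2e$, $[h,f]=-2f$. $\mathbf{Witt}_{>}$ is the complex Lie algebra with basis $\{L_k\}_{k\ge-1}$ and bracket $[L_i,L_j]=(i-j)L_{i+j}$; $\mathfrak{sl}(2)$ is embedded in it by $f\mapsto L_{-1}$, $h\mapsto-2L_0$, $e\mapsto-L_1$, and a $\mathbf{Witt}_{>}$-module structure on an $\mathfrak{sl}(2)$-module is compatible if its restriction along this embedding is the given $\mathfrak{sl}(2)$-structure. A class $\xi\in\mathbb C/2\mathbb Z$ is regarded as a subset of $\mathbb C$. The dense module $\mathbb V(\xi,\tau)$ is the vector space with basis $\{v_\mu:\mu\in\xi\}$ and action $f v_\mu=v_{\mu-2}$, $h v_\mu=\mu v_\mu$, $e v_\mu=\frac14(\tau-(\mu+1)^2)v_{\mu+2}$.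 The Pochhammer symbol is $P(z,n)=z(z+1)\cdots(z+n-1)$ for $n\ge0$ and $P(z,n)=\frac1{(z+n)(z+n+1)\cdots(z-1)}$ for $n\le-1$. *)

theory Defs
  imports "HOL-Analysis.Analysis" "HOL-Library.Poly_Mapping" "HOL-Library.FuncSet"
begin

section \<open>Lie algebras and their modules\<close>

text \<open>Lie algebras and modules are carried by linear subspaces \<open>G\<close>, \<open>V\<close> of ambient vector spaces;
  nothing is required of the operations outside these subspaces.\<close>

locale lie_algebra = vector_space scale
  for scale :: "'k::field \<Rightarrow> 'g::ab_group_add \<Rightarrow> 'g" +
  fixes G :: "'g set" and br :: "'g \<Rightarrow> 'g \<Rightarrow> 'g"
  assumes subspace_G: "subspace G"
    and br_closed: "x \<in> G \<Longrightarrow> y \<in> G \<Longrightarrow> br x y \<in> G"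
    and br_add_left: "x \<in> G \<Longrightarrow> y \<in> G \<Longrightarrow> z \<in> G \<Longrightarrow> br (x + y) z = br x z + br y z"
    and br_add_right: "x \<in> G \<Longrightarrow> y \<in> G \<Longrightarrow> z \<in> G \<Longrightarrow> br x (y + z) = br x y + br x z"
    and br_scale_left: "x \<in> G \<Longrightarrow> y \<in> G \<Longrightarrow> br (scale c x) y = scale c (br x y)"
    and br_scale_right: "x \<in> G \<Longrightarrow> y \<in> G \<Longrightarrow> br x (scale c y) = scale c (br x y)"
    and br_self: "x \<in> G \<Longrightarrow> br x x = 0"
    and jacobi: "x \<in> G \<Longrightarrow> y \<in> G \<Longrightarrow> z \<in> G \<Longrightarrow>
      br x (br y z) + br y (br z x) + br z (br x y) = 0"

locale lie_module = lie_algebra scale G br + mod: vector_space scaleV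
  for scale :: "'k::field \<Rightarrow> 'g::ab_group_add \<Rightarrow> 'g" and G br
    and scaleV :: "'k \<Rightarrow> 'v::ab_group_add \<Rightarrow> 'v" +
  fixes V :: "'v set" and act :: "'g \<Rightarrow> 'v \<Rightarrow> 'v"
  assumes subspace_V: "mod.subspace V"
    and act_closed: "x \<in> G \<Longrightarrow> v \<in> V \<Longrightarrow> act x v \<in> V"
    and act_add_left: "x \<in> G \<Longrightarrow> y \<in> G \<Longrightarrow> v \<in> V \<Longrightarrow> act (x + y) v = act x v + act y v"
    and act_add_right: "x \<in> G \<Longrightarrow> v \<in> V \<Longrightarrow> w \<in> V \<Longrightarrow> act x (v + w) = act x v + act x w"
    and act_scale_left: "x \<in> G \<Longrightarrow> v \<in> V \<Longrightarrow> act (scale c x) v = scaleV c (act x v)"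
    and act_scale_right: "x \<in> G \<Longrightarrow> v \<in> V \<Longrightarrow> act x (scaleV c v) = scaleV c (act x v)"
    and act_br: "x \<in> G \<Longrightarrow> y \<in> G \<Longrightarrow> v \<in> V \<Longrightarrow>
      act (br x y) v = act x (act y v) - act y (act x v)"


section \<open>Complex vector spaces with a given basis\<close>

definition fscale :: "complex \<Rightarrow> ('b \<Rightarrow>\<^sub>0 complex) \<Rightarrow> 'b \<Rightarrow>\<^sub>0 complex" where
  "fscale c x = Poly_Mapping.map (\<lambda>a. c * a) x"

definition basis :: "'b \<Rightarrow> 'b \<Rightarrow>\<^sub>0 complex" where
  "basis b = Poly_Mapping.single b 1"

definition free_space :: "'b set \<Rightarrow> ('b \<Rightarrow>\<^sub>0 complex) set" where
  "free_space B = {x. Poly_Mapping.keys x \<subseteq> B}"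

definition extend :: "('b \<Rightarrow> 'c \<Rightarrow>\<^sub>0 complex) \<Rightarrow> ('b \<Rightarrow>\<^sub>0 complex) \<Rightarrow> 'c \<Rightarrow>\<^sub>0 complex" where
  "extend F x = (\<Sum>b\<in>Poly_Mapping.keys x. fscale (Poly_Mapping.lookup x b) (F b))"

lemma lookup_fscale [simp]: "Poly_Mapping.lookup (fscale c x) b = c * Poly_Mapping.lookup x b"
  by (simp add: fscale_def Poly_Mapping.map.rep_eq when_def)

interpretation fvs: vector_space fscale
  by standard (auto intro!: poly_mapping_eqI simp: lookup_add algebra_simps)

lemma extend_superset:
  "finite S \<Longrightarrow> Poly_Mapping.keys x \<subseteq> S \<Longrightarrow>
    extend F x = (\<Sum>b\<in>S. fscale (Poly_Mapping.lookup x b) (F b))"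
  unfolding extend_def by (rule sum.mono_neutral_left) (auto simp: in_keys_iff)

lemma extend_add [simp]: "extend F (x + y) = extend F x + extend F y"
proof -
  let ?S = "Poly_Mapping.keys x \<union> Poly_Mapping.keys y"
  show ?thesis
    using extend_superset[of ?S x F] extend_superset[of ?S y F] extend_superset[of ?S "x + y" F]
      keys_add[of x y]
    by (simp add: lookup_add fvs.scale_left_distrib sum.distrib)
qed

lemma extend_scale [simp]: "extend F (fscale c x) = fscale c (extend F x)"
proof -
  have "Poly_Mapping.keys (fscale c x) \<subseteq> Poly_Mapping.keys x"
    by (auto simp: in_keys_iff)
  then have "extend F (fscale c x) =
      (\<Sum>b\<in>Poly_Mapping.keys x. fscale (c * Poly_Mapping.lookup x b) (F b))"
    using extend_superset[OF finite_keys, of "fscale c x" x F] by simp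
  then show ?thesis
    by (simp only: extend_def fvs.scale_sum_right fvs.scale_scale)
qed

lemma extend_basis [simp]: "extend F (basis b) = F b"
  by (simp add: extend_def basis_def)

lemma extend_fun_add: "extend (\<lambda>b. F b + H b) x = extend F x + extend H x"
  by (simp add: extend_def fvs.scale_right_distrib sum.distrib)

lemma extend_fun_scale: "extend (\<lambda>b. fscale c (F b)) x = fscale c (extend F x)"
  by (simp only: extend_def fvs.scale_sum_right fvs.scale_scale mult.commute)

lemma subspace_free_space: "fvs.subspace (free_space B)"
proof -
  have "Poly_Mapping.keys (x + y) \<subseteq> B"
    if "Poly_Mapping.keys x \<subseteq> B" "Poly_Mapping.keys y \<subseteq> B" for x y :: "'a \<Rightarrow>\<^sub>0 complex"
    using keys_add[of x y] that by blast
  moreover have "Poly_Mapping.keys (fscale c x) \<subseteq> Poly_Mapping.keys x"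
    for c and x :: "'a \<Rightarrow>\<^sub>0 complex"
    by (auto simp: in_keys_iff)
  ultimately show ?thesis
    unfolding fvs.subspace_def free_space_def by (simp, blast)
qed

lemma basis_in_free_space [simp]: "basis b \<in> free_space B \<longleftrightarrow> b \<in> B"
  by (simp add: free_space_def basis_def)

lemma free_space_induct [consumes 1, case_names zero basis add scale]:
  assumes "x \<in> free_space B"
    and "P 0" and "\<And>b. b \<in> B \<Longrightarrow> P (basis b)"
    and "\<And>x y. x \<in> free_space B \<Longrightarrow> y \<in> free_space B \<Longrightarrow> P x \<Longrightarrow> P y \<Longrightarrow> P (x + y)"
    and "\<And>c x. x \<in> free_space B \<Longrightarrow> P x \<Longrightarrow> P (fscale c x)"
  shows "P x"
proof -
  have *: "(\<Sum>b\<in>S. fscale (Poly_Mapping.lookup x b) (basis b)) \<in> free_space B \<and>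
      P (\<Sum>b\<in>S. fscale (Poly_Mapping.lookup x b) (basis b))" if "finite S" "S \<subseteq> B" for S
    using that
  proof (induction S)
    case empty
    then show ?case using assms(2) fvs.subspace_0[OF subspace_free_space] by simp
  next
    case (insert b S)
    then have b: "b \<in> B" by simp
    then have "basis b \<in> free_space B" by simp
    then have "fscale (Poly_Mapping.lookup x b) (basis b) \<in> free_space B"
        "P (fscale (Poly_Mapping.lookup x b) (basis b))"
      using assms(3)[OF b] assms(5) by (blast intro: fvs.subspace_scale[OF subspace_free_space])+
    with insert show ?case
      by (simp add: assms(4) fvs.subspace_add[OF subspace_free_space])
  qed
  define y where "y = (\<Sum>b\<in>Poly_Mapping.keys x. fscale (Poly_Mapping.lookup x b) (basis b))"
  have "Poly_Mapping.lookup x k = Poly_Mapping.lookup y k" for k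
  proof -
    have "Poly_Mapping.lookup y k =
        (\<Sum>b\<in>Poly_Mapping.keys x. if b = k then Poly_Mapping.lookup x b else 0)"
      unfolding y_def lookup_sum by (rule sum.cong) (auto simp: basis_def lookup_single)
    then show ?thesis
      by (simp add: in_keys_iff)
  qed
  then have "x = y" by (rule poly_mapping_eqI)
  moreover have "P y"
    using *[of "Poly_Mapping.keys x"] assms(1) unfolding y_def free_space_def by simp
  ultimately show ?thesis by simp
qed


section \<open>The Lie algebra \<open>sl(2)\<close>\<close>

definition sl2 :: "(complex^2^2) set" where
  "sl2 = {A. trace A = 0}"

definition mat_scale :: "complex \<Rightarrow> complex^2^2 \<Rightarrow> complex^2^2" where
  "mat_scale c A = (\<chi> i j. c * A $ i $ j)"

definition commutator :: "complex^2^2 \<Rightarrow> complex^2^2 \<Rightarrow> complex^2^2" where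
  "commutator A B = A ** B - B ** A"

lemma lie_algebra_sl2: "lie_algebra mat_scale sl2 commutator"
proof -
  interpret vector_space mat_scale
    by standard (auto simp: mat_scale_def vec_eq_iff algebra_simps)
  have "subspace sl2"
    by (auto simp: subspace_def sl2_def mat_scale_def trace_def sum_2 add_eq_0_iff)
  then show ?thesis
    by unfold_locales
      (auto simp: sl2_def commutator_def mat_scale_def trace_def matrix_matrix_mult_def
        vec_eq_iff sum_2 forall_2 algebra_simps)
qed

text \<open>The Chevalley basis: a traceless matrix is \<open>A\<^sub>1\<^sub>1 h + A\<^sub>1\<^sub>2 e + A\<^sub>2\<^sub>1 f\<close>.\<close>

definition sl2_e :: "complex^2^2" where "sl2_e = vector [vector [0, 1], vector [0, 0]]"
definition sl2_f :: "complex^2^2" where "sl2_f = vector [vector [0, 0], vector [1, 0]]"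
definition sl2_h :: "complex^2^2" where "sl2_h = vector [vector [1, 0], vector [0, -1]]"

lemma sl2_relations:
  "commutator sl2_e sl2_f = sl2_h"
  "commutator sl2_h sl2_e = mat_scale 2 sl2_e"
  "commutator sl2_h sl2_f = mat_scale (-2) sl2_f"
  by (simp_all add: commutator_def sl2_e_def sl2_f_def sl2_h_def mat_scale_def
      matrix_matrix_mult_def vec_eq_iff sum_2 forall_2)

lemma sl2_expand:
  "A \<in> sl2 \<Longrightarrow> A = mat_scale (A $ 1 $ 1) sl2_h + mat_scale (A $ 1 $ 2) sl2_e + mat_scale (A $ 2 $ 1) sl2_f"
  by (simp add: sl2_def trace_def sl2_e_def sl2_f_def sl2_h_def mat_scale_def
      vec_eq_iff sum_2 forall_2 eq_neg_iff_add_eq_0 add.commute)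


section \<open>The Lie algebra \<open>Witt\<^sub>>\<close>\<close>

text \<open>\<open>basis k\<close> is \<open>L\<^sub>k\<close>; the bracket is that of the Witt algebra with basis indexed by all
  integers, of which \<open>witt_pos\<close> is the subalgebra spanned by the \<open>L\<^sub>k\<close> with \<open>k \<ge> -1\<close>.\<close>

definition witt_pos :: "(int \<Rightarrow>\<^sub>0 complex) set" where
  "witt_pos = free_space {-1..}"

definition witt_bracket :: "(int \<Rightarrow>\<^sub>0 complex) \<Rightarrow> (int \<Rightarrow>\<^sub>0 complex) \<Rightarrow> int \<Rightarrow>\<^sub>0 complex" where
  "witt_bracket x y = extend (\<lambda>i. extend (\<lambda>j. fscale (of_int (i - j)) (basis (i + j))) y) x"

lemma witt_bracket_basis [simp]:
  "witt_bracket (basis i) (basis j) = fscale (of_int (i - j)) (basis (i + j))"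
  by (simp add: witt_bracket_def)

lemma witt_bracket_linear:
  "witt_bracket (x + y) z = witt_bracket x z + witt_bracket y z"
  "witt_bracket x (y + z) = witt_bracket x y + witt_bracket x z"
  "witt_bracket (fscale c x) y = fscale c (witt_bracket x y)"
  "witt_bracket x (fscale c y) = fscale c (witt_bracket x y)"
  by (simp_all add: witt_bracket_def extend_fun_add extend_fun_scale)

lemma witt_bracket_zero [simp]: "witt_bracket 0 x = 0" "witt_bracket x 0 = 0"
  using witt_bracket_linear(3)[of 0 0 x] witt_bracket_linear(4)[of x 0 0] by simp_all

lemma free_space_UNIV [simp]: "x \<in> free_space UNIV"
  by (simp add: free_space_def)

lemma witt_bracket_skew: "witt_bracket x y = - witt_bracket y x"
proof -
  have b: "witt_bracket x (basis j) = - witt_bracket (basis j) x" for j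
  proof (induction x rule: free_space_induct[OF free_space_UNIV])
    case (2 i)
    have "of_int (i - j) = - (of_int (j - i) :: complex)" by simp
    then show ?case by (simp only: witt_bracket_basis add.commute[of i j] fvs.scale_minus_left)
  qed (simp_all add: witt_bracket_linear)
  show ?thesis
  proof (induction y rule: free_space_induct[OF free_space_UNIV])
    case (2 j)
    show ?case by (rule b)
  qed (simp_all add: witt_bracket_linear)
qed

lemma witt_jacobi:
  "witt_bracket x (witt_bracket y z) + witt_bracket y (witt_bracket z x)
    + witt_bracket z (witt_bracket x y) = 0"
    (is "?J x y z = 0")
proof -
  have add: "?J (x + x') y z = ?J x y z + ?J x' y z"
    and scale: "?J (fscale c x) y z = fscale c (?J x y z)" for x x' y z c
    by (simp_all add: witt_bracket_linear fvs.scale_right_distrib add_ac)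
  have cyc: "?J x y z = ?J y z x" for x y z
    by (simp add: add_ac)
  have ext: "?J x y z = 0" if "\<And>i. ?J (basis i) y z = 0" for x y z
    using that by (induction x rule: free_space_induct[OF free_space_UNIV])
      (simp_all only: add scale fvs.scale_zero_right witt_bracket_zero add_0_left add_0_right)
  have 1: "?J (basis i) (basis j) (basis k) = 0" for i j k
  proof -
    have "of_int (j - k) * of_int (i - (j + k)) + of_int (k - i) * of_int (j - (k + i))
        + of_int (i - j) * of_int (k - (i + j)) = (0::complex)"
      by (simp add: algebra_simps)
    moreover have "j + (k + i) = i + (j + k)" "k + (i + j) = i + (j + k)"
      by simp_all
    ultimately show ?thesis
      by (simp only: witt_bracket_linear witt_bracket_basis fvs.scale_scale
          fvs.scale_zero_left flip: fvs.scale_left_distrib)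
  qed
  have 2: "?J x (basis j) (basis k) = 0" for x j k
    by (rule ext) (rule 1)
  have 3: "?J y (basis k) x = 0" for x y k
    by (rule ext, rule trans[OF cyc[symmetric]]) (rule 2)
  have 4: "?J z x y = 0"
    by (rule ext, rule trans[OF cyc[symmetric]]) (rule 3)
  show ?thesis
    by (rule trans[OF cyc[of z x y, symmetric] 4])
qed

lemma subspace_witt_pos: "fvs.subspace witt_pos"
  by (simp add: witt_pos_def subspace_free_space)

lemma witt_bracket_closed:
  assumes "x \<in> witt_pos" "y \<in> witt_pos"
  shows "witt_bracket x y \<in> witt_pos"
proof -
  note cl = fvs.subspace_0[OF subspace_witt_pos] fvs.subspace_add[OF subspace_witt_pos]
    fvs.subspace_scale[OF subspace_witt_pos]
  have b: "witt_bracket (basis i) (basis j) \<in> witt_pos" if "i \<ge> -1" "j \<ge> -1" for i j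
  proof (cases "i = j")
    case True
    then show ?thesis by (simp add: cl)
  next
    case False
    with that have "i + j \<ge> -1" by linarith
    then have "basis (i + j) \<in> witt_pos" by (simp add: witt_pos_def)
    then show ?thesis by (simp add: cl)
  qed
  have c: "witt_bracket x (basis j) \<in> witt_pos" if "j \<ge> -1" for j
    using assms(1) unfolding witt_pos_def
    by (induction x rule: free_space_induct)
      (use b that cl in \<open>simp_all add: witt_bracket_linear flip: witt_pos_def\<close>)
  show ?thesis
    using assms(2) unfolding witt_pos_def
    by (induction y rule: free_space_induct)
      (use c cl in \<open>simp_all add: witt_bracket_linear flip: witt_pos_def\<close>)
qed

lemma lie_algebra_witt_pos: "lie_algebra fscale witt_pos witt_bracket"
proof unfold_locales
  fix x
  show "witt_bracket x x = 0"
  proof (rule poly_mapping_eqI)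
    fix k
    have "Poly_Mapping.lookup (witt_bracket x x) k = - Poly_Mapping.lookup (witt_bracket x x) k"
      by (subst witt_bracket_skew) simp
    then show "Poly_Mapping.lookup (witt_bracket x x) k = Poly_Mapping.lookup 0 k"
      by (simp add: eq_neg_iff_add_eq_0)
  qed
qed (simp_all add: subspace_witt_pos witt_bracket_closed witt_bracket_linear witt_jacobi)

definition sl2_embed :: "complex^2^2 \<Rightarrow> int \<Rightarrow>\<^sub>0 complex" where
  "sl2_embed A = fscale (A $ 1 $ 1) (fscale (-2) (basis 0)) + fscale (A $ 1 $ 2) (- basis 1)
    + fscale (A $ 2 $ 1) (basis (-1))"

lemma sl2_embed_chevalley:
  "sl2_embed sl2_f = basis (-1)"
  "sl2_embed sl2_h = fscale (-2) (basis 0)"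
  "sl2_embed sl2_e = - basis 1"
  by (simp_all add: sl2_embed_def sl2_e_def sl2_f_def sl2_h_def)


section \<open>Dense modules\<close>

definition even_shift :: "(complex \<times> complex) set" where
  "even_shift = {(a, b). \<exists>k::int. a - b = 2 * of_int k}"

lemma equiv_even_shift: "equiv UNIV even_shift"
proof (rule equivI)
  show "sym even_shift"
  proof (rule symI)
    fix a b assume "(a, b) \<in> even_shift"
    then obtain k :: int where "a - b = 2 * of_int k" by (auto simp: even_shift_def)
    then have "b - a = 2 * of_int (- k)" by (simp add: algebra_simps)
    then show "(b, a) \<in> even_shift" unfolding even_shift_def by blast
  qed
  show "trans even_shift"
  proof (rule transI)
    fix a b c assume "(a, b) \<in> even_shift" "(b, c) \<in> even_shift"
    then obtain k l :: int where "a - b = 2 * of_int k" "b - c = 2 * of_int l"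
      by (auto simp: even_shift_def)
    then have "a - c = 2 * of_int (k + l)" by (simp add: algebra_simps)
    then show "(a, c) \<in> even_shift" unfolding even_shift_def by blast
  qed
qed (auto simp: even_shift_def refl_on_def intro: exI[of _ 0])

text \<open>\<open>basis \<mu>\<close> is \<open>v\<^sub>\<mu>\<close>.  The module \<open>V(\<xi>,\<tau>)\<close> is the space \<open>free_space \<xi>\<close> with the action
  \<open>dense_act \<tau>\<close>.\<close>

definition dense_e :: "complex \<Rightarrow> (complex \<Rightarrow>\<^sub>0 complex) \<Rightarrow> complex \<Rightarrow>\<^sub>0 complex" where
  "dense_e \<tau> = extend (\<lambda>\<mu>. fscale (1/4 * (\<tau> - (\<mu> + 1)^2)) (basis (\<mu> + 2)))"

definition dense_f :: "(complex \<Rightarrow>\<^sub>0 complex) \<Rightarrow> complex \<Rightarrow>\<^sub>0 complex" where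
  "dense_f = extend (\<lambda>\<mu>. basis (\<mu> - 2))"

definition dense_h :: "(complex \<Rightarrow>\<^sub>0 complex) \<Rightarrow> complex \<Rightarrow>\<^sub>0 complex" where
  "dense_h = extend (\<lambda>\<mu>. fscale \<mu> (basis \<mu>))"

definition dense_act :: "complex \<Rightarrow> complex^2^2 \<Rightarrow> (complex \<Rightarrow>\<^sub>0 complex) \<Rightarrow> complex \<Rightarrow>\<^sub>0 complex" where
  "dense_act \<tau> A v = fscale (A $ 1 $ 1) (dense_h v) + fscale (A $ 1 $ 2) (dense_e \<tau> v)
    + fscale (A $ 2 $ 1) (dense_f v)"


lemma dense_linear:
  "dense_e \<tau> (x + y) = dense_e \<tau> x + dense_e \<tau> y" "dense_e \<tau> (fscale c x) = fscale c (dense_e \<tau> x)"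
  "dense_f (x + y) = dense_f x + dense_f y" "dense_f (fscale c x) = fscale c (dense_f x)"
  "dense_h (x + y) = dense_h x + dense_h y" "dense_h (fscale c x) = fscale c (dense_h x)"
  by (simp_all add: dense_e_def dense_f_def dense_h_def)

lemma dense_zero: "dense_e \<tau> 0 = 0" "dense_f 0 = 0" "dense_h 0 = 0"
  by (simp_all add: dense_e_def dense_f_def dense_h_def extend_def)

lemma dense_basis:
  "dense_e \<tau> (basis \<mu>) = fscale (1/4 * (\<tau> - (\<mu> + 1)^2)) (basis (\<mu> + 2))"
  "dense_f (basis \<mu>) = basis (\<mu> - 2)"
  "dense_h (basis \<mu>) = fscale \<mu> (basis \<mu>)"
  by (simp_all add: dense_e_def dense_f_def dense_h_def)

lemma dense_relations:
  "dense_e \<tau> (dense_f v) = dense_f (dense_e \<tau> v) + dense_h v"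
  "dense_h (dense_e \<tau> v) = dense_e \<tau> (dense_h v) + fscale 2 (dense_e \<tau> v)"
  "dense_h (dense_f v) = dense_f (dense_h v) + fscale (-2) (dense_f v)"
proof -
  have ef: "dense_e \<tau> (dense_f (basis \<mu>)) = dense_f (dense_e \<tau> (basis \<mu>)) + dense_h (basis \<mu>)" for \<mu>
  proof -
    have "1/4 * (\<tau> - (\<mu> - 2 + 1)^2) = 1/4 * (\<tau> - (\<mu> + 1)^2) + \<mu>"
      by (simp add: power2_eq_square field_simps)
    then show ?thesis
      by (simp only: dense_basis dense_linear diff_add_cancel add_diff_cancel_right'
          fvs.scale_left_distrib)
  qed
  have he: "dense_h (dense_e \<tau> (basis \<mu>)) = dense_e \<tau> (dense_h (basis \<mu>)) + fscale 2 (dense_e \<tau> (basis \<mu>))" for \<mu>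
    by (simp only: dense_basis dense_linear fvs.scale_scale flip: fvs.scale_left_distrib)
      (rule arg_cong[of _ _ "\<lambda>c. fscale c _"], simp add: field_simps)
  have hf: "dense_h (dense_f (basis \<mu>)) = dense_f (dense_h (basis \<mu>)) + fscale (-2) (dense_f (basis \<mu>))" for \<mu>
    by (simp only: dense_basis dense_linear fvs.scale_scale flip: fvs.scale_left_distrib) simp
  show "dense_e \<tau> (dense_f v) = dense_f (dense_e \<tau> v) + dense_h v"
    by (induction v rule: free_space_induct[OF free_space_UNIV])
      (simp_all add: ef dense_linear dense_zero fvs.scale_right_distrib add_ac)
  show "dense_h (dense_e \<tau> v) = dense_e \<tau> (dense_h v) + fscale 2 (dense_e \<tau> v)"
    by (induction v rule: free_space_induct[OF free_space_UNIV])
      (simp_all only: he dense_linear dense_zero fvs.scale_right_distrib add_ac fvs.scale_zero_right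
        fvs.scale_scale mult_ac add_0_left)
  show "dense_h (dense_f v) = dense_f (dense_h v) + fscale (-2) (dense_f v)"
    by (induction v rule: free_space_induct[OF free_space_UNIV])
      (simp_all only: hf dense_linear dense_zero fvs.scale_right_distrib add_ac fvs.scale_zero_right
        fvs.scale_scale mult_ac add_0_left)
qed

lemma even_shift_class_closed:
  assumes "\<xi> \<in> UNIV // even_shift" "\<mu> \<in> \<xi>"
  shows "\<mu> + 2 * of_int k \<in> \<xi>"
proof -
  have "(\<mu>, \<mu> + 2 * of_int k) \<in> even_shift"
    unfolding even_shift_def by (auto intro!: exI[of _ "- k"])
  then show ?thesis
    using in_quotient_imp_closed[OF equiv_even_shift assms] by blast
qed

lemma extend_closed:
  assumes "v \<in> free_space B" "\<And>b. b \<in> B \<Longrightarrow> F b \<in> free_space C"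
  shows "extend F v \<in> free_space C"
  using assms(1)
  by (induction v rule: free_space_induct)
    (simp_all add: assms(2) extend_def[of F 0] fvs.subspace_0[OF subspace_free_space]
      fvs.subspace_add[OF subspace_free_space] fvs.subspace_scale[OF subspace_free_space])

lemma lie_module_dense:
  assumes "\<xi> \<in> UNIV // even_shift"
  shows "lie_module mat_scale sl2 commutator fscale (free_space \<xi>) (dense_act \<tau>)"
proof -
  interpret lie_algebra mat_scale sl2 commutator by (rule lie_algebra_sl2)
  note cl = fvs.subspace_add[OF subspace_free_space] fvs.subspace_scale[OF subspace_free_space]
  have shift: "\<mu> + 2 \<in> \<xi>" "\<mu> - 2 \<in> \<xi>" if "\<mu> \<in> \<xi>" for \<mu>
    using even_shift_class_closed[OF assms that, of 1] even_shift_class_closed[OF assms that, of "-1"]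
    by simp_all
  show ?thesis
  proof unfold_locales
    show "fvs.subspace (free_space \<xi>)" by (rule subspace_free_space)
  next
    fix A v assume v: "v \<in> free_space \<xi>"
    have "dense_e \<tau> v \<in> free_space \<xi>" "dense_f v \<in> free_space \<xi>" "dense_h v \<in> free_space \<xi>"
      unfolding dense_e_def dense_f_def dense_h_def
      by (auto intro!: extend_closed[OF v] cl shift)
    then show "dense_act \<tau> A v \<in> free_space \<xi>"
      by (simp add: dense_act_def cl)
  next
    fix A B v assume "A \<in> sl2" "B \<in> sl2"
    then have tr: "A $ 2 $ 2 = - A $ 1 $ 1" "B $ 2 $ 2 = - B $ 1 $ 1"
      by (simp_all add: sl2_def trace_def sum_2 eq_neg_iff_add_eq_0 add.commute)
    show "dense_act \<tau> (commutator A B) v = dense_act \<tau> A (dense_act \<tau> B v) - dense_act \<tau> B (dense_act \<tau> A v)"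
      by (rule poly_mapping_eqI)
        (simp add: dense_act_def dense_linear dense_relations tr commutator_def
          matrix_matrix_mult_def sum_2 lookup_add lookup_minus algebra_simps)
  qed (rule poly_mapping_eqI, simp add: dense_act_def mat_scale_def dense_linear lookup_add algebra_simps)+
qed


section \<open>Compatible structures\<close>

text \<open>A structure is a function on \<open>witt_pos\<close> whose values are functions on \<open>free_space \<xi>\<close>; the
  extensional function space makes equality of structures mean agreement on these subspaces.\<close>

definition compatible_structures ::
  "complex set \<Rightarrow> complex \<Rightarrow> ((int \<Rightarrow>\<^sub>0 complex) \<Rightarrow> (complex \<Rightarrow>\<^sub>0 complex) \<Rightarrow> complex \<Rightarrow>\<^sub>0 complex) set" where
  "compatible_structures \<xi> \<tau> = {\<rho> \<in> witt_pos \<rightarrow>\<^sub>E (free_space \<xi> \<rightarrow>\<^sub>E free_space \<xi>).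
     lie_module fscale witt_pos witt_bracket fscale (free_space \<xi>) \<rho> \<and>
     (\<forall>A\<in>sl2. \<forall>v\<in>free_space \<xi>. \<rho> (sl2_embed A) v = dense_act \<tau> A v)}"

definition Poch :: "complex \<Rightarrow> int \<Rightarrow> complex" where
  "Poch z n = (if n \<ge> 0 then pochhammer z (nat n) else 1 / (\<Prod>k\<in>{n..-1}. z + of_int k))"

text \<open>The case distinction matters: for \<open>i = -1\<close> the general expression is \<open>0/0\<close>, hence \<open>0\<close> in HOL,
  when \<open>\<mu> = 1 - s\<close>.\<close>

definition rho_coeff :: "complex \<Rightarrow> int \<Rightarrow> complex \<Rightarrow> complex" where
  "rho_coeff s i \<mu> = (if i = -1 then 1
     else (-1) powi i / 2 * (of_int i * (s - 1) - \<mu>) * Poch (1/2 * (1 + \<mu> + s)) i)"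

definition rho :: "complex set \<Rightarrow> complex \<Rightarrow>
    (int \<Rightarrow>\<^sub>0 complex) \<Rightarrow> (complex \<Rightarrow>\<^sub>0 complex) \<Rightarrow> complex \<Rightarrow>\<^sub>0 complex" where
  "rho \<xi> s = (\<lambda>x\<in>witt_pos. \<lambda>v\<in>free_space \<xi>.
     extend (\<lambda>i. extend (\<lambda>\<mu>. fscale (rho_coeff s i \<mu>) (basis (\<mu> + 2 * of_int i))) v) x)"

lemma rho_basis:
  "i \<ge> -1 \<Longrightarrow> \<mu> \<in> \<xi> \<Longrightarrow>
    rho \<xi> s (basis i) (basis \<mu>) = fscale (rho_coeff s i \<mu>) (basis (\<mu> + 2 * of_int i))"
  by (simp add: rho_def witt_pos_def)

end

theory Submission
  imports Defs
begin

text \<open>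
  Compatibility prescribes the action of \<open>L\<^sub>0\<close>, so \<open>L\<^sub>i\<close> shifts weights by \<open>2 i\<close>.  As all weight spaces of
  the dense module are lines, a compatible structure is the same as a family of coefficients
  \<open>L\<^sub>i v\<^sub>\<mu> = a\<^sub>i(\<mu>) v\<^sub>\<mu>\<^sub>+\<^sub>2\<^sub>i\<close> with \<open>a\<^sub>-\<^sub>1\<close>, \<open>a\<^sub>0\<close> and \<open>a\<^sub>1\<close> prescribed, subject to one identity for each bracket
  (\<open>witt_coeffs\<close>, \<open>compatible_structure_coeffs\<close>).

  Existence: with \<open>b\<^sub>i(\<mu>) = (i (s - 1) - \<mu>) / 2\<close> and \<open>z = (1 + \<mu> + s) / 2\<close> the coefficients of \<open>rho\<close> are
  \<open>(-1)\<^sup>i b\<^sub>i(\<mu>) P(z, i)\<close>.  Passing from \<open>\<mu>\<close> to \<open>\<mu> + 2 j\<close> replaces \<open>z\<close> by \<open>z + j\<close> and \<open>b\<^sub>i\<close> by \<open>b\<^sub>i - j\<close>, and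
  \<open>P(z, j) P(z + j, i) = P(z, i + j)\<close>.  For \<open>i, j \<ge> 0\<close> the bracket identity therefore reduces to
  \<open>(b\<^sub>i - j) b\<^sub>j - (b\<^sub>j - i) b\<^sub>i = (i - j) b\<^sub>i\<^sub>+\<^sub>j\<close>, which holds because \<open>b\<^sub>i\<close> is affine in \<open>i\<close>;
  brackets with \<open>L\<^sub>-\<^sub>1\<close> reduce in the same way to an identity between affine factors.

  Uniqueness: brackets with \<open>L\<^sub>1\<close> produce all \<open>L\<^sub>i\<close> with \<open>i > 2\<close> from \<open>L\<^sub>2\<close>, so \<open>a\<^sub>2\<close> determines the structure
  (\<open>compatible_structures_eqI_L2\<close>).  The bracket \<open>[L\<^sub>-\<^sub>1, L\<^sub>2]\<close> determines \<open>a\<^sub>2\<close> up to an additive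
  constant \<open>C\<close>, because \<open>\<xi>\<close> is a single orbit of the shift by \<open>2\<close>; the constant is measured from the coefficient of \<open>rho\<close> at \<open>s\<close>.  Finally \<open>L\<^sub>5\<close> arises both from \<open>[L\<^sub>1, L\<^sub>4]\<close> and
  from \<open>[L\<^sub>2, L\<^sub>3]\<close>, and equating the two gives \<open>C (2 C + s (s\<^sup>2 - 1)) = 0\<close> (\<open>witt_coeffs_two\<close>).  The
  root \<open>C = 0\<close> is the structure at \<open>s\<close>, the root \<open>C = - s (s\<^sup>2 - 1) / 2\<close> is the one at \<open>- s\<close>; they coincide
  exactly when \<open>s (s\<^sup>2 - 1) = 0\<close>, that is, when \<open>\<tau> = s\<^sup>2\<close> is \<open>0\<close> or \<open>1\<close>.
\<close>


section \<open>Coefficient families\<close>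

text \<open>Comparison of coefficients of \<open>v\<^sub>\<mu>\<^sub>+\<^sub>2\<^sub>i\<^sub>+\<^sub>2\<^sub>j\<close> in the bracket relation for \<open>L\<^sub>i\<close>, \<open>L\<^sub>j\<close> applied to \<open>v\<^sub>\<mu>\<close>.  For
  \<open>i = j = -1\<close> the coefficient \<open>a\<^sub>-\<^sub>2\<close>, which belongs to no element of \<open>Witt\<^sub>>\<close>, is multiplied by \<open>0\<close>.\<close>

definition witt_coeffs :: "complex set \<Rightarrow> (int \<Rightarrow> complex \<Rightarrow> complex) \<Rightarrow> bool" where
  "witt_coeffs \<xi> a \<longleftrightarrow> (\<forall>i\<ge>-1. \<forall>j\<ge>-1. \<forall>\<mu>\<in>\<xi>.
     of_int (i - j) * a (i + j) \<mu> = a i (\<mu> + 2 * of_int j) * a j \<mu> - a j (\<mu> + 2 * of_int i) * a i \<mu>)"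

lemma witt_coeffsD:
  "witt_coeffs \<xi> a \<Longrightarrow> i \<ge> -1 \<Longrightarrow> j \<ge> -1 \<Longrightarrow> \<mu> \<in> \<xi> \<Longrightarrow>
    of_int (i - j) * a (i + j) \<mu> = a i (\<mu> + 2 * of_int j) * a j \<mu> - a j (\<mu> + 2 * of_int i) * a i \<mu>"
  by (simp add: witt_coeffs_def)

lemma rho_coeff_minus_one [simp]: "rho_coeff s (-1) \<mu> = 1"
  by (simp add: rho_coeff_def)

lemma rho_coeff_of_nat:
  "rho_coeff s (int n) \<mu> = (-1) ^ n * ((of_nat n * (s - 1) - \<mu>) / 2) * pochhammer ((1 + \<mu> + s) / 2) n"
  by (simp add: rho_coeff_def Poch_def)

lemma rho_coeff_one: "rho_coeff s 1 \<mu> = ((\<mu> + 1)^2 - s^2) / 4"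
  using rho_coeff_of_nat[of s 1 \<mu>] by (simp add: power2_eq_square field_simps)

lemma rho_coeff_zero: "rho_coeff s 0 \<mu> = - \<mu> / 2"
  using rho_coeff_of_nat[of s 0 \<mu>] by simp

lemma rho_coeff_two: "rho_coeff s 2 \<mu> = (2 * (s - 1) - \<mu>) * (1 + \<mu> + s) * (3 + \<mu> + s) / 8"
  using rho_coeff_of_nat[of s 2 \<mu>]
  by (simp add: numeral_2_eq_2 pochhammer_Suc field_simps)

text \<open>The two candidates for \<open>L\<^sub>2\<close> differ by a constant, which is what governs their coincidence.\<close>

lemma rho_coeff_two_uminus: "rho_coeff (- s) 2 \<mu> = rho_coeff s 2 \<mu> - s * (s^2 - 1) / 2"
  by (simp add: rho_coeff_two field_simps power2_eq_square)

text \<open>For nonnegative indices the symbols \<open>P(z, m)\<close> multiply as \<open>P(z, n) P(z + n, m) = P(z, m + n)\<close>; after this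
  common factor is removed, an identity between the affine factors \<open>b\<close> remains.\<close>

lemma rho_coeff_bracket_nat:
  "of_int (int m - int n) * rho_coeff s (int m + int n) \<mu> =
    rho_coeff s (int m) (\<mu> + 2 * of_nat n) * rho_coeff s (int n) \<mu>
    - rho_coeff s (int n) (\<mu> + 2 * of_nat m) * rho_coeff s (int m) \<mu>"
proof -
  define z where "z = (1 + \<mu> + s) / 2"
  define p where "p = (-1) ^ (m + n) * pochhammer z (m + n)"
  define b where "b k = (of_nat k * (s - 1) - \<mu>) / 2" for k :: nat
  have p: "(-1)^k * pochhammer (z + of_nat l) k * ((-1)^l * pochhammer z l)
      = (-1) ^ (l + k) * pochhammer z (l + k)" for k l
    by (simp add: pochhammer_product' power_add)
  have shift: "rho_coeff s (int k) (\<mu> + 2 * of_nat l)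
      = (b k - of_nat l) * ((-1)^k * pochhammer (z + of_nat l) k)" for k l
  proof -
    have "(1 + (\<mu> + 2 * of_nat l) + s) / 2 = z + of_nat l"
      by (simp add: z_def field_simps)
    moreover have "(of_nat k * (s - 1) - (\<mu> + 2 * of_nat l)) / 2 = b k - of_nat l"
      by (simp add: b_def field_simps)
    ultimately show ?thesis
      by (simp only: rho_coeff_of_nat mult_ac)
  qed
  have val: "rho_coeff s (int k) \<mu> = b k * ((-1)^k * pochhammer z k)" for k
    by (simp add: rho_coeff_of_nat b_def z_def)
  have prod: "rho_coeff s (int k) (\<mu> + 2 * of_nat l) * rho_coeff s (int l) \<mu>
      = (b k - of_nat l) * b l * ((-1) ^ (l + k) * pochhammer z (l + k))" for k l
    unfolding shift val p[symmetric] by (simp only: mult_ac)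
  have "rho_coeff s (int m) (\<mu> + 2 * of_nat n) * rho_coeff s (int n) \<mu>
      - rho_coeff s (int n) (\<mu> + 2 * of_nat m) * rho_coeff s (int m) \<mu>
      = ((b m - of_nat n) * b n - (b n - of_nat m) * b m) * p"
    unfolding prod p_def by (simp only: add.commute[of n m] left_diff_distrib)
  also have "(b m - of_nat n) * b n - (b n - of_nat m) * b m = (of_nat m - of_nat n) * b (m + n)"
    by (simp add: b_def field_simps)
  finally show ?thesis
    using val[of "m + n"] by (simp add: p_def mult_ac)
qed

text \<open>The brackets with \<open>L\<^sub>-\<^sub>1\<close> need a separate argument, because the coefficient of \<open>L\<^sub>-\<^sub>1\<close> is \<open>1\<close> by convention.
  Here the common factor is \<open>P(z, n - 1)\<close>, since \<open>P(z - 1, n) = (z - 1) P(z, n - 1)\<close> and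
  \<open>P(z, n) = P(z, n - 1) (z + n - 1)\<close>.\<close>

lemma rho_coeff_bracket_minus_one:
  "of_nat (n + 1) * rho_coeff s (int n - 1) \<mu> = rho_coeff s (int n) (\<mu> - 2) - rho_coeff s (int n) \<mu>"
proof (cases n)
  case 0
  then show ?thesis by (simp add: rho_coeff_zero field_simps)
next
  case (Suc m)
  define z where "z = (1 + \<mu> + s) / 2"
  define p where "p = (-1) ^ m * pochhammer z m"
  define b where "b k = (of_nat k * (s - 1) - \<mu>) / 2" for k :: nat
  have arg: "(1 + (\<mu> - 2) + s) / 2 = z - 1"
    by (simp add: z_def field_simps)
  have poch: "pochhammer (z - 1) n = (z - 1) * pochhammer z m"
    by (simp add: Suc pochhammer_rec)
  have lin: "(of_nat n * (s - 1) - (\<mu> - 2)) / 2 = b n + 1"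
    by (simp add: b_def field_simps)
  have sign: "(-1) ^ n = - ((-1) ^ m :: complex)"
    by (simp add: Suc)
  have 1: "rho_coeff s (int n) (\<mu> - 2) = - ((b n + 1) * (z - 1) * p)"
    unfolding rho_coeff_of_nat arg poch lin sign p_def
    by (simp only: mult_ac mult_minus_left mult_minus_right)
  have 2: "rho_coeff s (int n) \<mu> = - (b n * (z + of_nat m) * p)"
    unfolding rho_coeff_of_nat Suc z_def[symmetric] by (simp add: pochhammer_Suc p_def b_def mult_ac)
  have 3: "rho_coeff s (int n - 1) \<mu> = b m * p"
    using rho_coeff_of_nat[of s m \<mu>] by (simp add: Suc p_def b_def z_def)
  have "of_nat (n + 1) * b m = b n * (z + of_nat m) - (b n + 1) * (z - 1)"
    by (simp add: z_def b_def Suc field_simps)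
  then have "of_nat (n + 1) * b m * p = (b n * (z + of_nat m) - (b n + 1) * (z - 1)) * p"
    by (rule arg_cong)
  then show ?thesis
    unfolding 1 2 3 by (simp only: left_diff_distrib mult.assoc minus_diff_minus diff_minus_eq_add) simp
qed

lemma int_ge_minus_one_cases:
  assumes "i \<ge> (-1::int)"
  obtains "i = -1" | n where "i = int n"
  using assms by (cases "i = -1") (auto intro!: that(2)[of "nat i"])

lemma witt_coeffs_rho_coeff: "witt_coeffs \<xi> (rho_coeff s)"
  unfolding witt_coeffs_def
proof (intro allI impI ballI)
  fix i j :: int and \<mu> assume "i \<ge> -1" "j \<ge> -1"
  have minus_one: "of_int (int n + 1) * rho_coeff s (int n - 1) \<mu>
      = rho_coeff s (int n) (\<mu> - 2) - rho_coeff s (int n) \<mu>" for n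
    using rho_coeff_bracket_minus_one[of n s \<mu>] by (simp add: add.commute)
  from \<open>i \<ge> -1\<close> show "of_int (i - j) * rho_coeff s (i + j) \<mu> =
      rho_coeff s i (\<mu> + 2 * of_int j) * rho_coeff s j \<mu> - rho_coeff s j (\<mu> + 2 * of_int i) * rho_coeff s i \<mu>"
  proof (cases rule: int_ge_minus_one_cases)
    case 1
    from \<open>j \<ge> -1\<close> show ?thesis
    proof (cases rule: int_ge_minus_one_cases)
      case (2 n)
      then show ?thesis using \<open>i = -1\<close> minus_one[of n] by (simp add: algebra_simps)
    qed (simp add: \<open>i = -1\<close>)
  next
    case (2 m)
    from \<open>j \<ge> -1\<close> show ?thesis
    proof (cases rule: int_ge_minus_one_cases)
      case 1
      then show ?thesis using 2 minus_one[of m] by simp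
    next
      case (2 n)
      then show ?thesis using \<open>i = int m\<close> rho_coeff_bracket_nat[of m n s \<mu>] by simp
    qed
  qed
qed

text \<open>The family is generated from its members \<open>1\<close> and \<open>2\<close>: the factor \<open>1 - i\<close> in the bracket of \<open>L\<^sub>1\<close> and
  \<open>L\<^sub>i\<close> does not vanish for \<open>i \<ge> 2\<close>, so the bracket determines \<open>L\<^sub>i\<^sub>+\<^sub>1\<close>.\<close>

lemma witt_coeffs_eqI:
  assumes a: "witt_coeffs \<xi> a" and b: "witt_coeffs \<xi> b"
    and shift: "\<And>\<mu>. \<mu> \<in> \<xi> \<Longrightarrow> \<mu> + 2 \<in> \<xi>"
    and one: "\<And>\<mu>. \<mu> \<in> \<xi> \<Longrightarrow> a 1 \<mu> = b 1 \<mu>"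
    and two: "\<And>\<mu>. \<mu> \<in> \<xi> \<Longrightarrow> a 2 \<mu> = b 2 \<mu>"
    and "i \<ge> 1" "\<mu> \<in> \<xi>"
  shows "a i \<mu> = b i \<mu>"
proof -
  have shift_nat: "\<mu> + 2 * of_nat n \<in> \<xi>" if "\<mu> \<in> \<xi>" for \<mu> n
  proof (induction n)
    case (Suc n)
    then show ?case using shift[of "\<mu> + 2 * of_nat n"] by (simp add: algebra_simps)
  qed (simp add: that)
  have "\<forall>\<mu>\<in>\<xi>. a (int n + 2) \<mu> = b (int n + 2) \<mu>" for n
  proof (induction n)
    case (Suc n)
    show ?case
    proof
      fix \<mu> assume \<mu>: "\<mu> \<in> \<xi>"
      have sum: "1 + (int n + 2) = int (Suc n) + 2" by simp
      have far: "\<mu> + 2 * of_int (int n + 2) \<in> \<xi>"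
        using shift_nat[OF \<mu>, of "n + 2"] by (simp add: algebra_simps)
      have near: "\<mu> + 2 * of_int 1 \<in> \<xi>"
        using shift[OF \<mu>] by simp
      have "of_int (1 - (int n + 2)) * a (int (Suc n) + 2) \<mu>
          = of_int (1 - (int n + 2)) * b (int (Suc n) + 2) \<mu>"
        using witt_coeffsD[OF a, of 1 "int n + 2" \<mu>] witt_coeffsD[OF b, of 1 "int n + 2" \<mu>]
        unfolding sum using Suc \<mu> one[OF \<mu>] one[OF far] near by simp
      moreover have "of_int (1 - (int n + 2)) \<noteq> (0::complex)"
        by (simp only: of_int_eq_0_iff)
      ultimately show "a (int (Suc n) + 2) \<mu> = b (int (Suc n) + 2) \<mu>"
        by simp
    qed
  qed (simp add: two)
  from this[of "nat (i - 2)"] have "a i \<mu> = b i \<mu>" if "i \<ge> 2"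
    using that \<open>\<mu> \<in> \<xi>\<close> by simp
  moreover from \<open>i \<ge> 1\<close> have "i = 1 \<or> i \<ge> 2"
    by linarith
  ultimately show ?thesis
    using one[OF \<open>\<mu> \<in> \<xi>\<close>] by auto
qed

text \<open>The last relation compares the two expressions \<open>[L\<^sub>1, L\<^sub>4] = -3 L\<^sub>5\<close> and \<open>[L\<^sub>2, L\<^sub>3] = - L\<^sub>5\<close> for the first
  member that arises from two different brackets of lower ones of positive index.\<close>

lemma witt_coeffs_relations:
  assumes a: "witt_coeffs \<xi> a" and \<mu>: "\<mu> \<in> \<xi>"
  shows "a 3 \<mu> = a 2 (\<mu> + 2) * a 1 \<mu> - a 1 (\<mu> + 4) * a 2 \<mu>"
    and "2 * a 4 \<mu> = a 3 (\<mu> + 2) * a 1 \<mu> - a 1 (\<mu> + 6) * a 3 \<mu>"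
    and "3 * (a 2 (\<mu> + 6) * a 3 \<mu> - a 3 (\<mu> + 4) * a 2 \<mu>) = a 1 (\<mu> + 8) * a 4 \<mu> - a 4 (\<mu> + 2) * a 1 \<mu>"
  using witt_coeffsD[OF a, of 1 2 \<mu>] witt_coeffsD[OF a, of 1 3 \<mu>]
    witt_coeffsD[OF a, of 1 4 \<mu>] witt_coeffsD[OF a, of 2 3 \<mu>] \<mu>
  by (simp_all add: algebra_simps)

text \<open>Write \<open>a\<^sub>2\<close> as the coefficient of \<open>rho\<close> at \<open>s\<close> plus \<open>C\<close>.  Then \<open>a\<^sub>3\<close> and \<open>a\<^sub>4\<close> deviate from \<open>rho\<close> by terms
  linear in \<open>C\<close>.  Both families satisfy the relation for \<open>L\<^sub>5\<close>, so in the difference of the two instances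
  only the terms that involve \<open>C\<close> survive; all dependence on \<open>\<mu>\<close> cancels, and a quadratic equation
  for \<open>C\<close> with roots \<open>0\<close> and \<open>- s (s\<^sup>2 - 1) / 2\<close> is left.\<close>

lemma witt_coeffs_two:
  assumes a: "witt_coeffs \<xi> a" and \<xi>: "\<xi> \<in> UNIV // even_shift"
    and minus_one: "\<And>\<mu>. \<mu> \<in> \<xi> \<Longrightarrow> a (-1) \<mu> = 1"
    and one: "\<And>\<mu>. \<mu> \<in> \<xi> \<Longrightarrow> a 1 \<mu> = ((\<mu> + 1)^2 - s^2) / 4"
  shows "(\<forall>\<mu>\<in>\<xi>. a 2 \<mu> = rho_coeff s 2 \<mu>) \<or> (\<forall>\<mu>\<in>\<xi>. a 2 \<mu> = rho_coeff (- s) 2 \<mu>)"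
proof -
  note shift = even_shift_class_closed[OF \<xi>]
  obtain \<mu>\<^sub>0 where \<mu>\<^sub>0: "\<xi> = even_shift `` {\<mu>\<^sub>0}"
    using \<xi> by (auto elim: quotientE)
  define c where "c \<mu> = a 2 \<mu> - rho_coeff s 2 \<mu>" for \<mu>
  \<comment> \<open>The bracket of \<open>L\<^sub>-\<^sub>1\<close> and \<open>L\<^sub>2\<close> fixes the differences of \<open>a\<^sub>2\<close> between neighbouring weights.\<close>
  have step: "c (\<mu> - 2) = c \<mu>" if "\<mu> \<in> \<xi>" for \<mu>
  proof -
    have "\<mu> + 2 * of_int 2 \<in> \<xi>" "\<mu> - 2 \<in> \<xi>"
      using shift[OF that, of 2] shift[OF that, of "-1"] by simp_all
    then have "- 3 * a 1 \<mu> = a 2 \<mu> - a 2 (\<mu> - 2)"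
      using witt_coeffsD[OF a, of "-1" 2 \<mu>] that by (simp add: minus_one)
    moreover have "- 3 * rho_coeff s 1 \<mu> = rho_coeff s 2 \<mu> - rho_coeff s 2 (\<mu> - 2)"
      using rho_coeff_bracket_minus_one[of 2 s \<mu>] by simp
    moreover have "a 1 \<mu> = rho_coeff s 1 \<mu>"
      using that by (simp add: one rho_coeff_one)
    ultimately show ?thesis
      by (simp add: c_def algebra_simps)
  qed
  have const: "c (\<mu> + 2 * of_int k) = c \<mu>" if "\<mu> \<in> \<xi>" for \<mu> k
  proof (induction k rule: int_induct[where k = 0])
    case (step1 i)
    then show ?case using step[OF shift[OF that, of "i + 1"]] by (simp add: algebra_simps)
  next
    case (step2 i)
    then show ?case using step[OF shift[OF that, of i]] by (simp add: algebra_simps)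
  qed simp
  have \<mu>\<^sub>0_in: "\<mu>\<^sub>0 \<in> \<xi>"
    unfolding \<mu>\<^sub>0 using equiv_class_self[OF equiv_even_shift] by simp
  define C where "C = c \<mu>\<^sub>0"
  have c: "c \<mu> = C" if "\<mu> \<in> \<xi>" for \<mu>
  proof -
    obtain k :: int where "\<mu>\<^sub>0 - \<mu> = 2 * of_int k"
      using \<open>\<mu> \<in> \<xi>\<close> unfolding \<mu>\<^sub>0 by (auto simp: even_shift_def)
    then have "\<mu>\<^sub>0 = \<mu> + 2 * of_int k" by (simp add: algebra_simps)
    then show ?thesis using const[OF that, of k] by (simp add: C_def)
  qed
  have two: "a 2 \<mu> = rho_coeff s 2 \<mu> + C" if "\<mu> \<in> \<xi>" for \<mu>
    using c[OF that] by (simp add: c_def algebra_simps)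
  have a1: "a 1 \<mu> = rho_coeff s 1 \<mu>" if "\<mu> \<in> \<xi>" for \<mu>
    using that by (simp add: one rho_coeff_one)
  have shift': "\<mu> + 2 \<in> \<xi>" "\<mu> + 4 \<in> \<xi>" "\<mu> + 6 \<in> \<xi>" "\<mu> + 8 \<in> \<xi>" if "\<mu> \<in> \<xi>" for \<mu>
    using shift[OF that, of 1] shift[OF that, of 2] shift[OF that, of 3] shift[OF that, of 4] by simp_all
  note three = witt_coeffs_relations(1)[OF a] and four = witt_coeffs_relations(2)[OF a]
    and five = witt_coeffs_relations(3)[OF a]
  have r3: "rho_coeff s 3 \<mu> = - (3 * (s - 1) - \<mu>) * (1 + \<mu> + s) * (3 + \<mu> + s) * (5 + \<mu> + s) / 16" for \<mu>
    using rho_coeff_of_nat[of s 3 \<mu>] by (simp add: numeral_3_eq_3 pochhammer_Suc field_simps)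
  have r3': "rho_coeff s 3 \<mu> = rho_coeff s 2 (\<mu> + 2) * rho_coeff s 1 \<mu> - rho_coeff s 1 (\<mu> + 4) * rho_coeff s 2 \<mu>"
    and r4: "2 * rho_coeff s 4 \<mu> = rho_coeff s 3 (\<mu> + 2) * rho_coeff s 1 \<mu> - rho_coeff s 1 (\<mu> + 6) * rho_coeff s 3 \<mu>"
    and r5: "3 * (rho_coeff s 2 (\<mu> + 6) * rho_coeff s 3 \<mu> - rho_coeff s 3 (\<mu> + 4) * rho_coeff s 2 \<mu>)
      = rho_coeff s 1 (\<mu> + 8) * rho_coeff s 4 \<mu> - rho_coeff s 4 (\<mu> + 2) * rho_coeff s 1 \<mu>" for \<mu>
    using witt_coeffs_relations[OF witt_coeffs_rho_coeff, of \<mu> UNIV s] by simp_all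
  \<comment> \<open>The deviations \<open>- (2 \<mu> + 6)\<close> and \<open>D\<close> below come from bracketing \<open>L\<^sub>1\<close> once and twice with the operator
    \<open>v\<^sub>\<mu> \<mapsto> v\<^sub>\<mu>\<^sub>+\<^sub>4\<close>.\<close>
  have a3: "a 3 \<mu> = rho_coeff s 3 \<mu> - C * (2 * \<mu> + 6)" if "\<mu> \<in> \<xi>" for \<mu>
    using that shift'[OF that]
    by (simp add: three r3' one two rho_coeff_one field_simps power2_eq_square)
  have a4: "a 4 \<mu> = rho_coeff s 4 \<mu> + C * (5 * \<mu>^2 + 40 * \<mu> + 71 + s^2) / 2" if "\<mu> \<in> \<xi>" for \<mu>
  proof -
    have "2 * a 4 \<mu> = 2 * rho_coeff s 4 \<mu> + C * (5 * \<mu>^2 + 40 * \<mu> + 71 + s^2)"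
      using that shift'[OF that]
      by (simp add: four r4 one a3 rho_coeff_one field_simps power2_eq_square)
    then show ?thesis by (simp add: field_simps)
  qed
  define D where "D \<mu> = (5 * \<mu>^2 + 40 * \<mu> + 71 + s^2) / 2" for \<mu>
  note in_class = \<mu>\<^sub>0_in shift'[OF \<mu>\<^sub>0_in]
  have "C * (24 * C + (3 * (rho_coeff s 3 \<mu>\<^sub>0 - rho_coeff s 3 (\<mu>\<^sub>0 + 4)
        - (2 * \<mu>\<^sub>0 + 6) * rho_coeff s 2 (\<mu>\<^sub>0 + 6) + (2 * \<mu>\<^sub>0 + 14) * rho_coeff s 2 \<mu>\<^sub>0)
      - (rho_coeff s 1 (\<mu>\<^sub>0 + 8) * D \<mu>\<^sub>0 - D (\<mu>\<^sub>0 + 2) * rho_coeff s 1 \<mu>\<^sub>0))) = 0"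
    using five[OF \<mu>\<^sub>0_in] r5[of \<mu>\<^sub>0] in_class
    by (simp add: a3 a4[unfolded times_divide_eq_right[symmetric] D_def[symmetric]] two a1 algebra_simps)
  moreover have "3 * (rho_coeff s 3 \<mu>\<^sub>0 - rho_coeff s 3 (\<mu>\<^sub>0 + 4)
        - (2 * \<mu>\<^sub>0 + 6) * rho_coeff s 2 (\<mu>\<^sub>0 + 6) + (2 * \<mu>\<^sub>0 + 14) * rho_coeff s 2 \<mu>\<^sub>0)
      - (rho_coeff s 1 (\<mu>\<^sub>0 + 8) * D \<mu>\<^sub>0 - D (\<mu>\<^sub>0 + 2) * rho_coeff s 1 \<mu>\<^sub>0) = 12 * (s * (s^2 - 1))"
    by (simp add: r3 rho_coeff_two rho_coeff_one D_def field_simps power2_eq_square)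
  ultimately have "C * (24 * C + 12 * (s * (s^2 - 1))) = 0"
    by (simp only:)
  moreover have "C * (24 * C + 12 * (s * (s^2 - 1))) = 12 * (C * (2 * C + s * (s^2 - 1)))"
    by (simp add: algebra_simps)
  ultimately have "C * (2 * C + s * (s^2 - 1)) = 0"
    by simp
  then consider "C = 0" | "2 * C + s * (s^2 - 1) = 0"
    by (simp only: mult_eq_0_iff) blast
  then show ?thesis
  proof cases
    case 1
    then show ?thesis by (simp add: two)
  next
    case 2
    have half: "x = - y / 2" if "2 * x + y = 0" for x y :: complex
      using that by (simp add: field_simps add_eq_0_iff)
    from half[OF 2] have "a 2 \<mu> = rho_coeff (- s) 2 \<mu>" if "\<mu> \<in> \<xi>" for \<mu>
      using that by (simp only: two rho_coeff_two_uminus) simp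
    then show ?thesis by blast
  qed
qed


section \<open>Existence of the two structures\<close>

definition graded_act ::
  "(int \<Rightarrow> complex \<Rightarrow> complex) \<Rightarrow> (int \<Rightarrow>\<^sub>0 complex) \<Rightarrow> (complex \<Rightarrow>\<^sub>0 complex) \<Rightarrow> complex \<Rightarrow>\<^sub>0 complex" where
  "graded_act a x v = extend (\<lambda>i. extend (\<lambda>\<mu>. fscale (a i \<mu>) (basis (\<mu> + 2 * of_int i))) v) x"

lemma graded_act_linear:
  "graded_act a (x + y) v = graded_act a x v + graded_act a y v"
  "graded_act a x (v + w) = graded_act a x v + graded_act a x w"
  "graded_act a (fscale c x) v = fscale c (graded_act a x v)"
  "graded_act a x (fscale c v) = fscale c (graded_act a x v)"
  by (simp_all add: graded_act_def extend_fun_add extend_fun_scale)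

lemma graded_act_zero [simp]: "graded_act a 0 v = 0" "graded_act a x 0 = 0"
  using graded_act_linear(3)[of a 0 0 v] graded_act_linear(4)[of a x 0 0] by simp_all

lemma graded_act_basis:
  "graded_act a (basis i) (basis \<mu>) = fscale (a i \<mu>) (basis (\<mu> + 2 * of_int i))"
  by (simp add: graded_act_def)

lemma graded_act_closed:
  assumes \<xi>: "\<xi> \<in> UNIV // even_shift" and v: "v \<in> free_space \<xi>"
  shows "graded_act a x v \<in> free_space \<xi>"
  unfolding graded_act_def
  by (rule extend_closed[OF free_space_UNIV], rule extend_closed[OF v],
      rule fvs.subspace_scale[OF subspace_free_space])
    (simp add: even_shift_class_closed[OF \<xi>])

text \<open>Both sides are linear in each argument, so the identity is only needed on basis vectors, where it is
  the defining relation of \<open>witt_coeffs\<close>.\<close>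

lemma graded_act_bracket:
  assumes a: "witt_coeffs \<xi> a"
    and x: "x \<in> witt_pos" and y: "y \<in> witt_pos" and v: "v \<in> free_space \<xi>"
  shows "graded_act a (witt_bracket x y) v
    = graded_act a x (graded_act a y v) - graded_act a y (graded_act a x v)"
    (is "?P x y v")
proof -
  have basis: "?P (basis i) (basis j) (basis \<mu>)" if "i \<ge> -1" "j \<ge> -1" "\<mu> \<in> \<xi>" for i j \<mu>
  proof -
    have comm: "\<mu> + 2 * of_int j + 2 * of_int i = \<mu> + 2 * of_int (i + j)"
      "\<mu> + 2 * of_int i + 2 * of_int j = \<mu> + 2 * of_int (i + j)"
      by simp_all
    show ?thesis
      unfolding witt_bracket_basis graded_act_linear graded_act_basis comm fvs.scale_scale
        fvs.scale_left_diff_distrib[symmetric]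
      using witt_coeffsD[OF a that] by (simp only: mult.commute)
  qed
  have basis2: "?P (basis i) (basis j) v" if "i \<ge> -1" "j \<ge> -1" for i j
    using v by (induction v rule: free_space_induct)
      (simp_all add: basis that graded_act_linear fvs.scale_right_diff_distrib del: witt_bracket_basis)
  have basis1: "?P (basis i) y v" if "i \<ge> -1" for i
    using y unfolding witt_pos_def by (induction y rule: free_space_induct)
      (simp_all add: basis2 that graded_act_linear witt_bracket_linear fvs.scale_right_diff_distrib
        del: witt_bracket_basis)
  show ?thesis
    using x unfolding witt_pos_def by (induction x rule: free_space_induct)
      (simp_all add: basis1 graded_act_linear witt_bracket_linear fvs.scale_right_diff_distrib
        del: witt_bracket_basis)
qed

lemma rho_eq_graded_act:
  "x \<in> witt_pos \<Longrightarrow> v \<in> free_space \<xi> \<Longrightarrow> rho \<xi> s x v = graded_act (rho_coeff s) x v"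
  by (simp add: rho_def graded_act_def)

lemma lie_module_rho:
  assumes \<xi>: "\<xi> \<in> UNIV // even_shift"
  shows "lie_module fscale witt_pos witt_bracket fscale (free_space \<xi>) (rho \<xi> s)"
proof -
  interpret lie_algebra fscale witt_pos witt_bracket by (rule lie_algebra_witt_pos)
  note cl = fvs.subspace_add[OF subspace_witt_pos] fvs.subspace_scale[OF subspace_witt_pos]
    fvs.subspace_add[OF subspace_free_space] fvs.subspace_scale[OF subspace_free_space]
    witt_bracket_closed graded_act_closed[OF \<xi>]
  show ?thesis
    by unfold_locales
      (simp_all add: rho_eq_graded_act cl subspace_free_space graded_act_linear
        graded_act_bracket[OF witt_coeffs_rho_coeff])
qed

lemma rho_compatible:
  assumes \<xi>: "\<xi> \<in> UNIV // even_shift"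
  shows "rho \<xi> s \<in> compatible_structures \<xi> (s^2)"
proof -
  have generators: "graded_act (rho_coeff s) (basis (-1)) v = dense_f v"
    "graded_act (rho_coeff s) (basis 0) v = fscale (-1/2) (dense_h v)"
    "graded_act (rho_coeff s) (basis 1) v = - dense_e (s^2) v" for v
  proof -
    have neg: "rho_coeff s 1 \<mu> = - (1/4 * (s^2 - (\<mu> + 1)^2))" for \<mu>
      by (simp add: rho_coeff_one field_simps)
    show "graded_act (rho_coeff s) (basis (-1)) v = dense_f v"
      by (simp add: graded_act_def dense_f_def)
    show "graded_act (rho_coeff s) (basis 0) v = fscale (-1/2) (dense_h v)"
      by (simp add: graded_act_def dense_h_def rho_coeff_zero flip: extend_fun_scale)
    show "graded_act (rho_coeff s) (basis 1) v = - dense_e (s^2) v"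
      unfolding graded_act_def dense_e_def extend_basis neg
      by (simp add: extend_def sum_negf)
  qed
  have "rho \<xi> s (sl2_embed A) v = dense_act (s^2) A v" if "v \<in> free_space \<xi>" for A v
  proof -
    have "sl2_embed A \<in> witt_pos"
      unfolding sl2_embed_def witt_pos_def
      by (intro fvs.subspace_add[OF subspace_free_space] fvs.subspace_scale[OF subspace_free_space]
          fvs.subspace_neg[OF subspace_free_space]) simp_all
    moreover have "graded_act (rho_coeff s) (- basis 1) v = dense_e (s^2) v"
      using graded_act_linear(3)[of "rho_coeff s" "-1" "basis 1" v] by (simp add: generators)
    ultimately show ?thesis
      unfolding rho_eq_graded_act[OF \<open>sl2_embed A \<in> witt_pos\<close> that]
      by (simp only: sl2_embed_def graded_act_linear generators dense_act_def) simp
  qed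
  moreover have "rho \<xi> s \<in> witt_pos \<rightarrow>\<^sub>E (free_space \<xi> \<rightarrow>\<^sub>E free_space \<xi>)"
    using graded_act_closed[OF \<xi>] by (auto simp: rho_def graded_act_def)
  ultimately show ?thesis
    using lie_module_rho[OF \<xi>] by (simp add: compatible_structures_def)
qed

section \<open>Uniqueness\<close>

lemma compatible_structures_eqI:
  assumes \<rho>: "\<rho> \<in> compatible_structures \<xi> \<tau>" and \<sigma>: "\<sigma> \<in> compatible_structures \<xi> \<tau>"
    and basis: "\<And>i \<mu>. i \<ge> -1 \<Longrightarrow> \<mu> \<in> \<xi> \<Longrightarrow> \<rho> (basis i) (basis \<mu>) = \<sigma> (basis i) (basis \<mu>)"
  shows "\<rho> = \<sigma>"
proof -
  interpret R: lie_module fscale witt_pos witt_bracket fscale "free_space \<xi>" \<rho>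
    using \<rho> by (simp add: compatible_structures_def)
  interpret S: lie_module fscale witt_pos witt_bracket fscale "free_space \<xi>" \<sigma>
    using \<sigma> by (simp add: compatible_structures_def)
  note zero = fvs.subspace_0[OF subspace_witt_pos] fvs.subspace_0[OF subspace_free_space]
  have zero_left: "\<rho> 0 v = 0" "\<sigma> 0 v = 0" if "v \<in> free_space \<xi>" for v
    using R.act_scale_left[OF zero(1) that, of 0] S.act_scale_left[OF zero(1) that, of 0] by simp_all
  have zero_right: "\<rho> x 0 = 0" "\<sigma> x 0 = 0" if "x \<in> witt_pos" for x
    using R.act_scale_right[OF that zero(2), of 0] S.act_scale_right[OF that zero(2), of 0] by simp_all
  have eq: "\<rho> x v = \<sigma> x v" if "x \<in> witt_pos" "v \<in> free_space \<xi>" for x v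
  proof -
    have bv: "\<rho> (basis i) v = \<sigma> (basis i) v" if i: "i \<ge> -1" for i
    proof -
      have "basis i \<in> witt_pos" using i by (simp add: witt_pos_def)
      with \<open>v \<in> free_space \<xi>\<close> show ?thesis
        by (induction v rule: free_space_induct)
          (simp_all add: R.act_add_right S.act_add_right R.act_scale_right S.act_scale_right
            zero_right basis i)
    qed
    from \<open>x \<in> witt_pos\<close>[unfolded witt_pos_def] show ?thesis
      by (induction x rule: free_space_induct)
        (use that(2) in \<open>simp_all add: R.act_add_left S.act_add_left R.act_scale_left S.act_scale_left
           zero_left bv flip: witt_pos_def\<close>)
  qed
  have mem: "\<rho> \<in> witt_pos \<rightarrow>\<^sub>E (free_space \<xi> \<rightarrow>\<^sub>E free_space \<xi>)"
    "\<sigma> \<in> witt_pos \<rightarrow>\<^sub>E (free_space \<xi> \<rightarrow>\<^sub>E free_space \<xi>)"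
    using \<rho> \<sigma> by (simp_all add: compatible_structures_def)
  show ?thesis
  proof (rule PiE_ext[OF mem])
    fix x assume x: "x \<in> witt_pos"
    show "\<rho> x = \<sigma> x"
      by (rule PiE_ext[OF PiE_mem[OF mem(1) x] PiE_mem[OF mem(2) x]]) (rule eq[OF x])
  qed
qed

lemma lookup_basis: "Poly_Mapping.lookup (basis b) k = (if k = b then 1 else 0)"
  by (simp add: basis_def lookup_single when_def)

lemma fscale_basis_inject: "fscale c (basis k) = fscale d (basis k) \<longleftrightarrow> c = d"
proof
  assume "fscale c (basis k) = fscale d (basis k)"
  from arg_cong[OF this, of "\<lambda>w. Poly_Mapping.lookup w k"] show "c = d"
    by (simp add: lookup_basis)
qed simp

lemma basis_nonzero [simp]: "basis b \<noteq> 0"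
  using lookup_basis[of b b] by auto

lemma lookup_dense_h: "Poly_Mapping.lookup (dense_h w) k = k * Poly_Mapping.lookup w k"
  by (induction w rule: free_space_induct[OF free_space_UNIV])
    (simp_all add: dense_zero dense_linear dense_basis lookup_add algebra_simps lookup_basis)

text \<open>The eigenspaces of \<open>h\<close> are lines.\<close>

lemma weight_vector:
  assumes "dense_h w = fscale k w"
  shows "w = fscale (Poly_Mapping.lookup w k) (basis k)"
proof (rule poly_mapping_eqI)
  fix m
  have "m * Poly_Mapping.lookup w m = k * Poly_Mapping.lookup w m"
    using arg_cong[OF assms, of "\<lambda>w. Poly_Mapping.lookup w m"] by (simp add: lookup_dense_h)
  then show "Poly_Mapping.lookup w m = Poly_Mapping.lookup (fscale (Poly_Mapping.lookup w k) (basis k)) m"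
    by (auto simp: lookup_basis)
qed

text \<open>Since \<open>h\<close> acts as \<open>-2 L\<^sub>0\<close> and \<open>[L\<^sub>0, L\<^sub>i] = - i L\<^sub>i\<close>, the vector \<open>L\<^sub>i v\<^sub>\<mu>\<close> is an eigenvector of \<open>h\<close> for
  \<open>\<mu> + 2 i\<close>, hence a multiple of a basis vector.\<close>

lemma compatible_structure_coeffs:
  assumes \<xi>: "\<xi> \<in> UNIV // even_shift" and \<rho>: "\<rho> \<in> compatible_structures \<xi> \<tau>"
  obtains a where "witt_coeffs \<xi> a"
    and "\<And>\<mu>. \<mu> \<in> \<xi> \<Longrightarrow> a (-1) \<mu> = 1"
    and "\<And>\<mu>. \<mu> \<in> \<xi> \<Longrightarrow> a 0 \<mu> = - \<mu> / 2"
    and "\<And>\<mu>. \<mu> \<in> \<xi> \<Longrightarrow> a 1 \<mu> = ((\<mu> + 1)^2 - \<tau>) / 4"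
    and "\<And>i \<mu>. i \<ge> -1 \<Longrightarrow> \<mu> \<in> \<xi> \<Longrightarrow> \<rho> (basis i) (basis \<mu>) = fscale (a i \<mu>) (basis (\<mu> + 2 * of_int i))"
proof -
  interpret lie_module fscale witt_pos witt_bracket fscale "free_space \<xi>" \<rho>
    using \<rho> by (simp add: compatible_structures_def)
  have L: "basis i \<in> witt_pos" if "i \<ge> -1" for i
    using that by (simp add: witt_pos_def)
  have compat: "\<rho> (sl2_embed A) v = dense_act \<tau> A v" if "A \<in> sl2" "v \<in> free_space \<xi>" for A v
    using \<rho> that by (simp add: compatible_structures_def)
  have sl2: "sl2_e \<in> sl2" "sl2_f \<in> sl2" "sl2_h \<in> sl2"
    by (simp_all add: sl2_def trace_def sum_2 sl2_e_def sl2_f_def sl2_h_def)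
  have f: "\<rho> (basis (-1)) v = dense_f v"
    and h: "fscale (-2) (\<rho> (basis 0) v) = dense_h v"
    and e: "fscale (-1) (\<rho> (basis 1) v) = dense_e \<tau> v" if "v \<in> free_space \<xi>" for v
    using compat[OF sl2(1) that] compat[OF sl2(2) that] compat[OF sl2(3) that]
      act_scale_left[OF L[of 0] that, of "-2"] act_scale_left[OF L[of 1] that, of "-1"]
    unfolding sl2_embed_chevalley
    by (simp_all add: dense_act_def sl2_e_def sl2_f_def sl2_h_def)
  define a where "a i \<mu> = Poly_Mapping.lookup (\<rho> (basis i) (basis \<mu>)) (\<mu> + 2 * of_int i)" for i \<mu>
  have act: "\<rho> (basis i) (basis \<mu>) = fscale (a i \<mu>) (basis (\<mu> + 2 * of_int i))"
    if i: "i \<ge> -1" and \<mu>: "\<mu> \<in> \<xi>" for i \<mu>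
    unfolding a_def
  proof (rule weight_vector)
    have v: "basis \<mu> \<in> free_space \<xi>" using \<mu> by simp
    let ?w = "\<rho> (basis i) (basis \<mu>)"
    have w: "?w \<in> free_space \<xi>" using act_closed[OF L[OF i] v] .
    have v0: "\<rho> (basis 0) (basis \<mu>) \<in> free_space \<xi>" by (rule act_closed[OF L v]) simp
    have "fscale (- of_int i) ?w = \<rho> (basis 0) ?w - \<rho> (basis i) (\<rho> (basis 0) (basis \<mu>))"
      using act_br[OF L[of 0] L[OF i] v]
      by (simp only: witt_bracket_basis add_0_left diff_0 of_int_minus act_scale_left[OF L[OF i] v])
    then have "fscale (-2) (fscale (- of_int i) ?w)
        = dense_h ?w - \<rho> (basis i) (fscale (-2) (\<rho> (basis 0) (basis \<mu>)))"
      using h[OF w] act_scale_right[OF L[OF i] v0, of "-2"]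
      by (simp only: fvs.scale_right_diff_distrib)
    also have "\<rho> (basis i) (fscale (-2) (\<rho> (basis 0) (basis \<mu>))) = fscale \<mu> ?w"
      unfolding h[OF v] dense_basis by (rule act_scale_right[OF L[OF i] v])
    finally have "dense_h ?w = fscale \<mu> ?w + fscale (2 * of_int i) ?w"
      by simp
    then show "dense_h ?w = fscale (\<mu> + 2 * of_int i) ?w"
      by (simp only: fvs.scale_left_distrib)
  qed
  have "witt_coeffs \<xi> a"
    unfolding witt_coeffs_def
  proof (intro allI impI ballI)
    fix i j \<mu> assume i: "i \<ge> (-1::int)" and j: "j \<ge> (-1::int)" and \<mu>: "\<mu> \<in> \<xi>"
    show "of_int (i - j) * a (i + j) \<mu> = a i (\<mu> + 2 * of_int j) * a j \<mu> - a j (\<mu> + 2 * of_int i) * a i \<mu>"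
    proof (cases "i = j")
      case False
      with i j have ij: "i + j \<ge> -1" by linarith
      have v: "basis \<mu> \<in> free_space \<xi>" using \<mu> by simp
      have twice: "\<rho> (basis k) (\<rho> (basis l) (basis \<mu>))
          = fscale (a k (\<mu> + 2 * of_int l) * a l \<mu>) (basis (\<mu> + 2 * of_int (k + l)))"
        if k: "k \<ge> -1" and l: "l \<ge> -1" for k l
      proof -
        have \<nu>: "\<mu> + 2 * of_int l \<in> \<xi>" by (rule even_shift_class_closed[OF \<xi> \<mu>])
        then have "basis (\<mu> + 2 * of_int l) \<in> free_space \<xi>" by simp
        from act_scale_right[OF L[OF k] this, of "a l \<mu>"] show ?thesis
          unfolding act[OF l \<mu>] act[OF k \<nu>] by (simp add: algebra_simps)
      qed
      have "fscale (of_int (i - j) * a (i + j) \<mu>) (basis (\<mu> + 2 * of_int (i + j)))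
          = \<rho> (witt_bracket (basis i) (basis j)) (basis \<mu>)"
        unfolding witt_bracket_basis act_scale_left[OF L[OF ij] v] act[OF ij \<mu>] by simp
      also have "\<dots> = \<rho> (basis i) (\<rho> (basis j) (basis \<mu>)) - \<rho> (basis j) (\<rho> (basis i) (basis \<mu>))"
        by (rule act_br[OF L[OF i] L[OF j] v])
      also have "\<dots> = fscale (a i (\<mu> + 2 * of_int j) * a j \<mu> - a j (\<mu> + 2 * of_int i) * a i \<mu>)
          (basis (\<mu> + 2 * of_int (i + j)))"
        unfolding twice[OF i j] twice[OF j i] add.commute[of j i] fvs.scale_left_diff_distrib ..
      finally show ?thesis
        by (simp only: fscale_basis_inject)
    qed simp
  qed
  moreover have "a (-1) \<mu> = 1" "a 0 \<mu> = - \<mu> / 2" "a 1 \<mu> = ((\<mu> + 1)^2 - \<tau>) / 4" if "\<mu> \<in> \<xi>" for \<mu>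
  proof -
    have v: "basis \<mu> \<in> free_space \<xi>" using that by simp
    show "a (-1) \<mu> = 1"
      using f[OF v] by (simp add: a_def dense_basis lookup_basis)
    have "- 2 * a 0 \<mu> = \<mu>"
      using arg_cong[OF h[OF v], of "\<lambda>w. Poly_Mapping.lookup w \<mu>"]
      by (simp add: a_def dense_basis lookup_basis)
    moreover have "a 0 \<mu> = - (- 2 * a 0 \<mu>) / 2"
      by simp
    ultimately show "a 0 \<mu> = - \<mu> / 2"
      by (simp only:)
    show "a 1 \<mu> = ((\<mu> + 1)^2 - \<tau>) / 4"
      using arg_cong[OF e[OF v], of "\<lambda>w. Poly_Mapping.lookup w (\<mu> + 2)"]
      by (simp add: a_def dense_basis lookup_basis lookup_minus field_simps)
  qed
  ultimately show ?thesis
    using act that by blast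
qed

text \<open>\<open>Witt\<^sub>>\<close> is generated by the image of \<open>sl(2)\<close> together with \<open>L\<^sub>2\<close>.\<close>

lemma compatible_structures_eqI_L2:
  assumes \<xi>: "\<xi> \<in> UNIV // even_shift"
    and \<rho>: "\<rho> \<in> compatible_structures \<xi> \<tau>" and \<sigma>: "\<sigma> \<in> compatible_structures \<xi> \<tau>"
    and L2: "\<And>\<mu>. \<mu> \<in> \<xi> \<Longrightarrow> \<rho> (basis 2) (basis \<mu>) = \<sigma> (basis 2) (basis \<mu>)"
  shows "\<rho> = \<sigma>"
proof (rule compatible_structures_eqI[OF \<rho> \<sigma>])
  fix i \<mu> assume i: "i \<ge> (-1::int)" and \<mu>: "\<mu> \<in> \<xi>"
  obtain a where a: "witt_coeffs \<xi> a"
    "\<And>\<mu>. \<mu> \<in> \<xi> \<Longrightarrow> a (-1) \<mu> = 1" "\<And>\<mu>. \<mu> \<in> \<xi> \<Longrightarrow> a 0 \<mu> = - \<mu> / 2"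
    "\<And>\<mu>. \<mu> \<in> \<xi> \<Longrightarrow> a 1 \<mu> = ((\<mu> + 1)^2 - \<tau>) / 4"
    "\<And>i \<mu>. i \<ge> -1 \<Longrightarrow> \<mu> \<in> \<xi> \<Longrightarrow> \<rho> (basis i) (basis \<mu>) = fscale (a i \<mu>) (basis (\<mu> + 2 * of_int i))"
    by (rule compatible_structure_coeffs[OF \<xi> \<rho>]) blast
  obtain b where b: "witt_coeffs \<xi> b"
    "\<And>\<mu>. \<mu> \<in> \<xi> \<Longrightarrow> b (-1) \<mu> = 1" "\<And>\<mu>. \<mu> \<in> \<xi> \<Longrightarrow> b 0 \<mu> = - \<mu> / 2"
    "\<And>\<mu>. \<mu> \<in> \<xi> \<Longrightarrow> b 1 \<mu> = ((\<mu> + 1)^2 - \<tau>) / 4"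
    "\<And>i \<mu>. i \<ge> -1 \<Longrightarrow> \<mu> \<in> \<xi> \<Longrightarrow> \<sigma> (basis i) (basis \<mu>) = fscale (b i \<mu>) (basis (\<mu> + 2 * of_int i))"
    by (rule compatible_structure_coeffs[OF \<xi> \<sigma>]) blast
  have two: "a 2 \<mu> = b 2 \<mu>" if "\<mu> \<in> \<xi>" for \<mu>
    using L2[OF that] a(5)[of 2, OF _ that] b(5)[of 2, OF _ that] by (simp add: fscale_basis_inject)
  have one: "a 1 \<mu> = b 1 \<mu>" if "\<mu> \<in> \<xi>" for \<mu>
    by (simp only: a(4) b(4) that)
  have pos: "a i \<mu> = b i \<mu>" if "i \<ge> 1"
    by (rule witt_coeffs_eqI[OF a(1) b(1)])
      (use even_shift_class_closed[OF \<xi>, of _ 1] one two \<mu> that in auto)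
  from i consider "i = -1" | "i = 0" | "i \<ge> 1" by linarith
  then have "a i \<mu> = b i \<mu>"
    by cases (simp_all add: a(2,3) b(2,3) \<mu> pos)
  then show "\<rho> (basis i) (basis \<mu>) = \<sigma> (basis i) (basis \<mu>)"
    by (simp add: a(5) b(5) i \<mu>)
qed

theorem proposition4p2:
  fixes \<xi> :: "complex set" and \<tau> s :: complex
  assumes "\<xi> \<in> UNIV // even_shift" and "s^2 = \<tau>"
  shows "finite (compatible_structures \<xi> \<tau>) \<and> card (compatible_structures \<xi> \<tau>) \<le> 2 \<and>
    compatible_structures \<xi> \<tau> = {rho \<xi> s, rho \<xi> (- s)} \<and>
    (rho \<xi> s = rho \<xi> (- s) \<longleftrightarrow> \<tau> = 0 \<or> \<tau> = 1)"
proof -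
  note \<xi> = assms(1)
  have rho: "rho \<xi> s \<in> compatible_structures \<xi> \<tau>" "rho \<xi> (- s) \<in> compatible_structures \<xi> \<tau>"
    using rho_compatible[OF \<xi>, of s] rho_compatible[OF \<xi>, of "- s"] assms(2) by simp_all
  have "\<rho> = rho \<xi> s \<or> \<rho> = rho \<xi> (- s)" if \<rho>: "\<rho> \<in> compatible_structures \<xi> \<tau>" for \<rho>
  proof -
    obtain a where a: "witt_coeffs \<xi> a" "\<And>\<mu>. \<mu> \<in> \<xi> \<Longrightarrow> a (-1) \<mu> = 1"
      "\<And>\<mu>. \<mu> \<in> \<xi> \<Longrightarrow> a 1 \<mu> = ((\<mu> + 1)^2 - \<tau>) / 4"
      and act: "\<And>i \<mu>. i \<ge> -1 \<Longrightarrow> \<mu> \<in> \<xi> \<Longrightarrow>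
        \<rho> (basis i) (basis \<mu>) = fscale (a i \<mu>) (basis (\<mu> + 2 * of_int i))"
      by (rule compatible_structure_coeffs[OF \<xi> \<rho>]) blast
    from witt_coeffs_two[OF a(1) \<xi> a(2), of s] a(3) assms(2)
    consider "\<forall>\<mu>\<in>\<xi>. a 2 \<mu> = rho_coeff s 2 \<mu>" | "\<forall>\<mu>\<in>\<xi>. a 2 \<mu> = rho_coeff (- s) 2 \<mu>"
      by auto
    then show ?thesis
    proof cases
      case 1
      then have "\<rho> = rho \<xi> s"
        by (intro compatible_structures_eqI_L2[OF \<xi> \<rho> rho(1)]) (simp add: act rho_basis)
      then show ?thesis ..
    next
      case 2
      then have "\<rho> = rho \<xi> (- s)"
        by (intro compatible_structures_eqI_L2[OF \<xi> \<rho> rho(2)]) (simp add: act rho_basis)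
      then show ?thesis ..
    qed
  qed
  with rho have eq: "compatible_structures \<xi> \<tau> = {rho \<xi> s, rho \<xi> (- s)}"
    by blast
  have iff: "s * (s^2 - 1) = 0 \<longleftrightarrow> \<tau> = 0 \<or> \<tau> = 1"
    using assms(2) by auto
  have "rho \<xi> s = rho \<xi> (- s) \<longleftrightarrow> s * (s^2 - 1) = 0"
  proof
    assume same: "rho \<xi> s = rho \<xi> (- s)"
    obtain \<mu> where \<mu>: "\<mu> \<in> \<xi>"
      using in_quotient_imp_non_empty[OF equiv_even_shift \<xi>] by blast
    have "rho_coeff s 2 \<mu> = rho_coeff (- s) 2 \<mu>"
      using rho_basis[OF _ \<mu>, of 2 s] rho_basis[OF _ \<mu>, of 2 "- s"] same
      by (simp add: fscale_basis_inject)
    then show "s * (s^2 - 1) = 0"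
      by (simp add: rho_coeff_two_uminus)
  next
    assume "s * (s^2 - 1) = 0"
    then have "rho_coeff (- s) 2 \<mu> = rho_coeff s 2 \<mu>" for \<mu>
      unfolding rho_coeff_two_uminus by (simp only:) simp
    then show "rho \<xi> s = rho \<xi> (- s)"
      by (intro compatible_structures_eqI_L2[OF \<xi> rho]) (simp add: rho_basis)
  qed
  moreover have "card {rho \<xi> s, rho \<xi> (- s)} \<le> 2"
    by (rule card_insert_le_m1) simp_all
  ultimately show ?thesis
    unfolding eq iff by simp
qed

end
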